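(* Let $\lambda/\mu$ be a skew shape with $n$ boxes, and let $\{n_T\}$ and $\{v_T\}$ ($T\in \mathrm{SYT}(\lambda/\mu)$) be the natural and seminormal bases of the $\mathbb{C}\mathbb{S}_n$-module $\mathbb{S}_n^{\lambda/\mu}$. For every $T\in\mathrm{SYT}(\lambda/\mu)$, $$n_T=\sum_{S\le T}A_{S,T}\,v_S,\qquad\text{with coefficients}\qquad A_{S,T}=\sum_{\omega\subseteq\pi}\mathrm{wt}_\pi(\omega),$$ where the first sum is over standard tableaux $S\in \mathrm{SYT}(\lambda/\mu)$ with $S\le T$ in (strong) Bruhat order, $\pi$ is any fixed path from the column reading tableau $C$ to $T$ in the weak Bruhat graph $\mathcal{B}_n^{\lambda/\mu}$, and the second sum is over all subpaths $\omega\subseteq\pi$ which terminate at $S$.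
   Context: Tableaux. A skew shape $\lambda/\mu$ (partitions $\mu\subseteq\lambda$) is the set of boxes in the diagram of $\lambda$ not in that of $\mu$; position $(x,y)$ means row $x$ (counted downward) and column $y$ of $\lambda$. A Young tableau of shape $\lambda/\mu$ ($n$ boxes) is a filling by $1,\dots,n$, each used once; it is standard if entries increase left to right in rows and top to bottom in columns. $\mathrm{SYT}(\lambda/\mu)$ is the set of standard tableaux. A permutation $\sigma\in\mathbb{S}_n$ acts on tableaux by replacing each entry $k$ by $\sigma(k)$. Write $s_i=(i,i+1)$, $1\le i\le n-1$. The column reading tableau $C$ is the standard tableau obtained by entering $1,\dots,n$ consecutively down the columns, beginning with the southwest-most connected component and filling columns from left to right. For a tableau $T$, $w_T\in\mathbb{S}_n$ is the unique permutation with $w_T(C)=T$. Bruhat order on $\mathrm{SYT}(\lambda/\mu)$: $S\le T$ iff $w_S\le w_T$ in strong Bruhat order on $\mathbb{S}_n$. Weak Bruhat graph. $\mathcal{B}_n^{\lambda/\mu}$ is the (undirected) graph with vertex set $\mathrm{SYT}(\lambda/\mu)$ and an edge labeled $s_i$ between $S$ and $T$ whenever $T=s_i(S)$. Modules. The content of a box $b$ in position $(x,y)$ of $\lambda$ is $ct(b)=y-x$. For $T\in\mathrm{SYT}(\lambda/\mu)$, let $T(i)$ be the box of $T$ containing $i$ and $a_i(T)=\dfrac{1}{ct(T(i+1))-ct(T(i))}$. $\mathbb{S}_n^{\lambda/\mu}$ is the $\mathbb{C}$-vector space with basis $\{v_T\mid T\in\mathrm{SYT}(\lambda/\mu)\}$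 (the seminormal basis), made into a $\mathbb{C}\mathbb{S}_n$-module by $$s_iv_T=a_i(T)v_T+(1+a_i(T))v_{s_i(T)},\qquad v_{s_i(T)}=0\text{ if }s_i(T)\text{ is nonstandard}.$$ The natural basis is $\{n_T\mid T\in\mathrm{SYT}(\lambda/\mu)\}$ with $n_T:=w_Tv_C$. Paths. A path of length $k\geq 0$ in $\mathcal{B}_n^{\lambda/\mu}$ from $T_0$ to $T_k$ is a sequence $\pi=(T_0\xrightarrow{s_{i_1}}T_1\xrightarrow{s_{i_2}}\cdots\xrightarrow{s_{i_k}}T_k)$ with all $T_j\in\mathrm{SYT}(\lambda/\mu)$ and $T_j=s_{i_j}(T_{j-1})$. A subpath $\omega\subseteq\pi$ is a sequence $\omega=(T_0=S_0\xrightarrow{z_1}S_1\xrightarrow{z_2}\cdots\xrightarrow{z_k}S_k)$ with all $S_j\in\mathrm{SYT}(\lambda/\mu)$, $z_j\in\{s_{i_j},e\}$ ($e$ the identity) and $S_j=z_j(S_{j-1})$; it terminates at $S_k$. Its $\pi$-weight is $\mathrm{wt}_\pi(\omega)=\prod_{j=1}^kb_j$, where $b_j=a_{i_j}(S_{j-1})$ if $z_j=e$ (i.e. $S_j=S_{j-1}$), and $b_j=1+a_{i_j}(S_{j-1})$ if $z_j=s_{i_j}$ (i.e. $S_j=s_{i_j}(S_{j-1})$); the empty path has weight $1$. *)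

theory Defs
  imports Complex_Main "HOL-Algebra.Sym_Groups" "HOL-Algebra.Group_Action"
begin

section \<open>Skew shapes and tableaux\<close>

type_synonym box = "nat \<times> nat"

definition is_partition :: "nat list \<Rightarrow> bool" where
  "is_partition lam \<longleftrightarrow> sorted_wrt (\<ge>) lam \<and> (\<forall>p\<in>set lam. 0 < p)"

text \<open>Boxes are pairs (row, column), both counted from 1, rows downward.\<close>

definition diagram :: "nat list \<Rightarrow> box set" where
  "diagram lam = {(x, y). 1 \<le> x \<and> x \<le> length lam \<and> 1 \<le> y \<and> y \<le> lam ! (x - 1)}"

definition skew :: "nat list \<Rightarrow> nat list \<Rightarrow> box set" where
  "skew lam mu = diagram lam - diagram mu"

definition content :: "box \<Rightarrow> int" where
  "content b = int (snd b) - int (fst b)"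

text \<open>
  A tableau of shape \<open>D\<close> is a function on all pairs which is 0 outside \<open>D\<close>, so that tableaux
  are equal iff they have the same entries. As a permutation of \<open>{1..n}\<close> fixes 0, it acts on
  tableaux by composition: \<open>\<sigma>(T) = \<sigma> \<circ> T\<close>.
\<close>

type_synonym tableau = "box \<Rightarrow> nat"

definition tableaux :: "box set \<Rightarrow> tableau set" where
  "tableaux D = {T. bij_betw T D {1..card D} \<and> (\<forall>b. b \<notin> D \<longrightarrow> T b = 0)}"

definition SYT :: "box set \<Rightarrow> tableau set" where
  "SYT D = {T \<in> tableaux D.
     (\<forall>x y y'. (x, y) \<in> D \<and> (x, y') \<in> D \<and> y < y' \<longrightarrow> T (x, y) < T (x, y')) \<and>
     (\<forall>x x' y. (x, y) \<in> D \<and> (x', y) \<in> D \<and> x < x' \<longrightarrow> T (x, y) < T (x', y))}"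

definition box_of :: "box set \<Rightarrow> tableau \<Rightarrow> nat \<Rightarrow> box" where
  "box_of D T i = inv_into D T i"

abbreviation s :: "nat \<Rightarrow> nat \<Rightarrow> nat" where
  "s i \<equiv> Transposition.transpose i (i + 1)"


section \<open>The column reading tableau\<close>

definition adjacent :: "box \<Rightarrow> box \<Rightarrow> bool" where
  "adjacent b c \<longleftrightarrow>
     (fst b = fst c \<and> (snd b = snd c + 1 \<or> snd c = snd b + 1)) \<or>
     (snd b = snd c \<and> (fst b = fst c + 1 \<or> fst c = fst b + 1))"

definition component :: "box set \<Rightarrow> box \<Rightarrow> box set" where
  "component D b = {c. (\<lambda>p q. p \<in> D \<and> q \<in> D \<and> adjacent p q)\<^sup>*\<^sup>* b c}"

definition southwest_of :: "box set \<Rightarrow> box set \<Rightarrow> bool" where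
  "southwest_of A B \<longleftrightarrow> (\<forall>b\<in>A. \<forall>c\<in>B. fst c < fst b \<and> snd b < snd c)"

text \<open>
  The order in which boxes are filled: components from southwest to northeast; within a component,
  columns from left to right and each column from top to bottom.
\<close>

definition read_before :: "box set \<Rightarrow> box \<Rightarrow> box \<Rightarrow> bool" where
  "read_before D b c \<longleftrightarrow>
     (if component D b = component D c
      then snd b < snd c \<or> (snd b = snd c \<and> fst b < fst c)
      else southwest_of (component D b) (component D c))"

definition col_reading :: "box set \<Rightarrow> tableau" where
  "col_reading D b = (if b \<in> D then card {c \<in> D. read_before D c b} + 1 else 0)"

definition tab_perm :: "box set \<Rightarrow> tableau \<Rightarrow> nat \<Rightarrow> nat" where
  "tab_perm D T = (THE w. w permutes {1..card D} \<and> w \<circ> col_reading D = T)"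


section \<open>Strong Bruhat order\<close>

text \<open>The Coxeter length of a permutation of \<open>{1..n}\<close> is its number of inversions.\<close>

definition perm_length :: "nat \<Rightarrow> (nat \<Rightarrow> nat) \<Rightarrow> nat" where
  "perm_length n w = card {(a, b). 1 \<le> a \<and> a < b \<and> b \<le> n \<and> w b < w a}"

definition bruhat_step :: "nat \<Rightarrow> (nat \<Rightarrow> nat) \<Rightarrow> (nat \<Rightarrow> nat) \<Rightarrow> bool" where
  "bruhat_step n u w \<longleftrightarrow>
     (\<exists>a b. 1 \<le> a \<and> a < b \<and> b \<le> n \<and> w = u \<circ> Transposition.transpose a b)
     \<and> perm_length n u < perm_length n w"

definition bruhat_le :: "nat \<Rightarrow> (nat \<Rightarrow> nat) \<Rightarrow> (nat \<Rightarrow> nat) \<Rightarrow> bool" where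
  "bruhat_le n = (bruhat_step n)\<^sup>*\<^sup>*"

definition tab_le :: "box set \<Rightarrow> tableau \<Rightarrow> tableau \<Rightarrow> bool" where
  "tab_le D S T \<longleftrightarrow> bruhat_le (card D) (tab_perm D S) (tab_perm D T)"


section \<open>The module and its two bases\<close>

definition seminormal_coeff :: "box set \<Rightarrow> nat \<Rightarrow> tableau \<Rightarrow> complex" where
  "seminormal_coeff D i T =
     1 / of_int (content (box_of D T (i + 1)) - content (box_of D T i))"

text \<open>
  The complex vector space with basis \<open>v T\<close>, for \<open>T\<close> in \<open>SYT D\<close>, carrying a linear action
  of the symmetric group (equivalently, a module structure over its group algebra) that is given
  on simple transpositions by Young's seminormal formula. The simple transpositions generate the
  group, so the formula determines the action.
\<close>

locale seminormal_module = vector_space scale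
  for scale :: "complex \<Rightarrow> 'v::ab_group_add \<Rightarrow> 'v" +
  fixes D :: "box set"
    and act :: "(nat \<Rightarrow> nat) \<Rightarrow> 'v \<Rightarrow> 'v"
    and v :: "tableau \<Rightarrow> 'v"
  assumes inj_v: "inj_on v (SYT D)"
    and independent_v: "independent (v ` SYT D)"
    and span_v: "span (v ` SYT D) = UNIV"
    and action: "group_action (sym_group (card D)) UNIV act"
    and linear_act: "p permutes {1..card D} \<Longrightarrow> Vector_Spaces.linear scale scale (act p)"
    and act_s: "T \<in> SYT D \<Longrightarrow> 1 \<le> i \<Longrightarrow> i < card D \<Longrightarrow>
      act (s i) (v T) =
        scale (seminormal_coeff D i T) (v T) +
        scale (1 + seminormal_coeff D i T) (if s i \<circ> T \<in> SYT D then v (s i \<circ> T) else 0)"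

definition natural_vector ::
  "box set \<Rightarrow> ((nat \<Rightarrow> nat) \<Rightarrow> 'v \<Rightarrow> 'v) \<Rightarrow> (tableau \<Rightarrow> 'v) \<Rightarrow> tableau \<Rightarrow> 'v" where
  "natural_vector D act v T = act (tab_perm D T) (v (col_reading D))"


section \<open>Paths in the weak Bruhat graph\<close>

definition weak_edge :: "box set \<Rightarrow> nat \<Rightarrow> tableau \<Rightarrow> tableau \<Rightarrow> bool" where
  "weak_edge D i S T \<longleftrightarrow>
     1 \<le> i \<and> i < card D \<and> S \<in> SYT D \<and> T \<in> SYT D \<and> T = s i \<circ> S"

text \<open>
  A path of length \<open>k\<close> is a pair of the list \<open>[T\<^sub>0, \<dots>, T\<^sub>k]\<close> of its vertices and the list
  \<open>[i\<^sub>1, \<dots>, i\<^sub>k]\<close> of the indices of its edge labels; a subpath is a pair of the list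
  \<open>[S\<^sub>0, \<dots>, S\<^sub>k]\<close> of its vertices and the list \<open>[z\<^sub>1, \<dots>, z\<^sub>k]\<close> of permutations.
\<close>

type_synonym path = "tableau list \<times> nat list"
type_synonym subpath = "tableau list \<times> (nat \<Rightarrow> nat) list"

definition is_path :: "box set \<Rightarrow> tableau \<Rightarrow> tableau \<Rightarrow> path \<Rightarrow> bool" where
  "is_path D T T' = (\<lambda>(Ts, is).
     length Ts = length is + 1 \<and> set Ts \<subseteq> SYT D \<and> hd Ts = T \<and> last Ts = T' \<and>
     (\<forall>j<length is. weak_edge D (is ! j) (Ts ! j) (Ts ! (j + 1))))"

definition is_subpath :: "box set \<Rightarrow> subpath \<Rightarrow> path \<Rightarrow> bool" where
  "is_subpath D = (\<lambda>(Ss, zs) (Ts, is).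
     length zs = length is \<and> length Ss = length zs + 1 \<and> set Ss \<subseteq> SYT D \<and> hd Ss = hd Ts \<and>
     (\<forall>j<length zs. zs ! j \<in> {s (is ! j), id} \<and> Ss ! (j + 1) = zs ! j \<circ> Ss ! j))"

definition terminus :: "subpath \<Rightarrow> tableau" where
  "terminus w = last (fst w)"

definition wt :: "box set \<Rightarrow> path \<Rightarrow> subpath \<Rightarrow> complex" where
  "wt D = (\<lambda>(Ts, is) (Ss, zs). \<Prod>j<length is.
     if zs ! j = id then seminormal_coeff D (is ! j) (Ss ! j)
     else 1 + seminormal_coeff D (is ! j) (Ss ! j))"

definition path_coeff :: "box set \<Rightarrow> path \<Rightarrow> tableau \<Rightarrow> complex" where
  "path_coeff D p S = (\<Sum>w \<in> {w. is_subpath D w p \<and> terminus w = S}. wt D p w)"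

end

theory Submission
  imports Defs
begin

text \<open>
  Write \<open>C\<close> for the column reading tableau and \<open>w\<^sub>T\<close> for the permutation that takes
  \<open>C\<close> to \<open>T\<close>. The labels of a path from \<open>C\<close> to \<open>T\<close>, read backwards, spell out a
  factorisation of \<open>w\<^sub>T\<close> into simple transpositions. When these factors are applied to
  \<open>v\<^sub>C\<close> one after the other by the seminormal formula, every factor splits each basis vector \<open>v\<^sub>S\<close> into the
  multiple of \<open>v\<^sub>S\<close> that is got by staying at \<open>S\<close> and the multiple of the vector reached by
  moving along the edge, if that edge stays among the standard tableaux. A sequence of such choices
  is a subpath and the product of the multiples is its weight. Hence, for every path,
  the natural vector is the sum over all standard \<open>S\<close> of the path coefficient times \<open>v\<^sub>S\<close>
  (\<open>natural_vector_path\<close>).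

  It remains to see that \<open>S\<close> only contributes if it is below \<open>T\<close> in Bruhat order. For
  an arbitrary path, subpaths may well end at other tableaux and only their total weight vanishes.
  But the \<open>v\<^sub>S\<close> are linearly independent, so the coefficients do not depend on the path, and it
  is enough to exhibit one path from \<open>C\<close> to \<open>T\<close> all of whose subpaths end below \<open>T\<close>
  (\<open>ex_reduced_path\<close>). This also gives the existence of a path.

  Such a path is a reduced one, and it is found by descending from \<open>T\<close>. If \<open>T\<close> is not
  \<open>C\<close>, then \<open>w\<^sub>T\<close> is not the identity, so for some \<open>i\<close> the box of \<open>i + 1\<close>
  comes before the box of \<open>i\<close> in \<open>C\<close>. As \<open>C\<close> is standard, these two boxes share
  neither a row nor a column, so exchanging \<open>i\<close> and \<open>i + 1\<close> leaves the tableau standard,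
  and it shortens the permutation (\<open>ex_weak_edge_below\<close>). That subpaths of a path
  built in this way stay below its end is the easy half of the subword property, which rests on the
  lifting lemma \<open>bruhat_le_s\<close>.

  Two things have to be supplied about the definitions: that \<open>C\<close> is a standard tableau at all,
  which is a statement about the geometry of connected components in a skew shape
  (\<open>col_reading_SYT\<close>), and that a transposition raises the number of inversions exactly when it
  exchanges two values in increasing order (\<open>bruhat_step_iff\<close>).
\<close>

section \<open>The column reading tableau is standard\<close>

definition order_convex :: "box set \<Rightarrow> bool" where
  "order_convex D \<longleftrightarrow> (\<forall>x y x' y' p q. (x, y) \<in> D \<longrightarrow> (x', y') \<in> D \<longrightarrow>
     x \<le> p \<longrightarrow> p \<le> x' \<longrightarrow> y \<le> q \<longrightarrow> q \<le> y' \<longrightarrow> (p, q) \<in> D)"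

lemma order_convexD:
  assumes "order_convex D" "(x, y) \<in> D" "(x', y') \<in> D"
    and "x \<le> p" "p \<le> x'" "y \<le> q" "q \<le> y'"
  shows "(p, q) \<in> D"
  using assms unfolding order_convex_def by blast

lemma diagram_downward_closed:
  assumes "is_partition lam" "(x, y) \<in> diagram lam" "1 \<le> p" "p \<le> x" "1 \<le> q" "q \<le> y"
  shows "(p, q) \<in> diagram lam"
proof -
  have "lam ! (x - 1) \<le> lam ! (p - 1)"
  proof (cases "p = x")
    case False
    then have "p - 1 < x - 1" "x - 1 < length lam"
      using assms by (auto simp: diagram_def)
    then show ?thesis
      using assms(1) unfolding is_partition_def by (metis sorted_wrt_nth_less)
  qed simp
  then show ?thesis
    using assms by (auto simp: diagram_def)
qed

lemma skew_order_convex: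
  assumes "is_partition lam" "is_partition mu"
  shows "order_convex (skew lam mu)"
  unfolding order_convex_def
proof (intro allI impI)
  fix x y x' y' p q
  assume 1: "(x, y) \<in> skew lam mu" "(x', y') \<in> skew lam mu"
    and le: "x \<le> p" "p \<le> x'" "y \<le> q" "q \<le> y'"
  have pos: "1 \<le> x" "1 \<le> y"
    using 1 by (auto simp: skew_def diagram_def)
  have "(p, q) \<in> diagram lam"
    using diagram_downward_closed[OF assms(1), of x' y' p q] 1 le pos by (auto simp: skew_def)
  moreover have "(p, q) \<notin> diagram mu"
    using diagram_downward_closed[OF assms(2), of p q x y] 1 le pos by (auto simp: skew_def)
  ultimately show "(p, q) \<in> skew lam mu"
    by (simp add: skew_def)
qed

lemma finite_skew: "finite (skew lam mu)"
proof -
  have "diagram lam = (SIGMA x:{1..length lam}. {1..lam ! (x - 1)})"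
    by (auto simp: diagram_def)
  then show ?thesis
    by (simp add: skew_def)
qed

text \<open>
  A relation of its own, so that reasoning about components can use the rules for an equivalence
  relation instead of the closure operator behind them.
\<close>

definition linked :: "box set \<Rightarrow> box \<Rightarrow> box \<Rightarrow> bool" where
  "linked D b c \<longleftrightarrow> c \<in> component D b"

definition box_southwest :: "box \<Rightarrow> box \<Rightarrow> bool" where
  "box_southwest b c \<longleftrightarrow> fst c < fst b \<and> snd b < snd c"

lemma linked_refl [simp]: "linked D b b"
  by (simp add: linked_def component_def)

lemma linked_adjacent:
  "linked D b c \<Longrightarrow> c \<in> D \<Longrightarrow> d \<in> D \<Longrightarrow> adjacent c d \<Longrightarrow> linked D b d"
  unfolding linked_def component_def by (auto intro: rtranclp.rtrancl_into_rtrancl)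

lemma linked_induct [consumes 1, case_names refl step]:
  assumes "linked D b c" and "P b"
    and "\<And>p q. linked D b p \<Longrightarrow> p \<in> D \<Longrightarrow> q \<in> D \<Longrightarrow> adjacent p q \<Longrightarrow> P p \<Longrightarrow> P q"
  shows "P c"
  using assms(1) unfolding linked_def component_def mem_Collect_eq
proof (induction rule: rtranclp_induct)
  case (step p q)
  then show ?case
    using assms(3)[of p q] by (simp add: linked_def component_def)
qed (rule assms(2))

lemma linked_trans:
  assumes "linked D b c" "linked D c d"
  shows "linked D b d"
  using assms(2) by (induction rule: linked_induct) (auto intro: assms(1) linked_adjacent)

lemma linked_sym:
  assumes "linked D b c"
  shows "linked D c b"
  using assms
proof (induction rule: linked_induct)
  case (step p q)
  have "adjacent q p"
    using step(4) by (auto simp: adjacent_def)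
  then have "linked D q p"
    using step(2,3) linked_adjacent[of D q q p] by simp
  then show ?case
    using step(5) linked_trans by blast
qed simp

lemma linked_mem: "linked D b c \<Longrightarrow> b \<in> D \<Longrightarrow> c \<in> D"
  by (induction rule: linked_induct)

lemma component_eq_iff: "component D b = component D c \<longleftrightarrow> linked D b c"
proof
  assume "component D b = component D c"
  then show "linked D b c"
    unfolding linked_def by (metis linked_def linked_refl)
next
  assume "linked D b c"
  then have "linked D b d \<longleftrightarrow> linked D c d" for d
    using linked_sym linked_trans by blast
  then show "component D b = component D c"
    by (auto simp: linked_def)
qed

text \<open>
  In an order convex set, the lattice path that goes from one box to a box weakly southeast of it
  never leaves the set. So boxes in different components are incomparable in the product order,
  which means that one of them lies strictly southwest of the other.
\<close>

lemma linked_southeast: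
  assumes "order_convex D" "(x, y) \<in> D" "(x', y') \<in> D" "x \<le> x'" "y \<le> y'"
  shows "linked D (x, y) (x', y')"
  using assms(2-)
proof (induction "(x' - x) + (y' - y)" arbitrary: x y rule: less_induct)
  case less
  consider "x = x'" "y = y'" | "x < x'" | "y < y'"
    using less.prems by linarith
  then show ?case
  proof cases
    case 2
    then have "(x + 1, y) \<in> D"
      using less.prems by (intro order_convexD[OF assms(1) less.prems(1,2)]) auto
    moreover from this have "linked D (x + 1, y) (x', y')"
      using less 2 by simp
    ultimately show ?thesis
      using less.prems(1) linked_trans linked_adjacent[OF linked_refl, of "(x, y)" D "(x + 1, y)"]
      by (auto simp: adjacent_def)
  next
    case 3
    then have "(x, y + 1) \<in> D"
      using less.prems by (intro order_convexD[OF assms(1) less.prems(1,2)]) auto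
    moreover from this have "linked D (x, y + 1) (x', y')"
      using less 3 by simp
    ultimately show ?thesis
      using less.prems(1) linked_trans linked_adjacent[OF linked_refl, of "(x, y)" D "(x, y + 1)"]
      by (auto simp: adjacent_def)
  qed simp
qed

lemma unlinked_box_southwest:
  assumes "order_convex D" "b \<in> D" "c \<in> D" "\<not> linked D b c"
  shows "box_southwest b c \<or> box_southwest c b"
proof -
  obtain x y x' y' where bc: "b = (x, y)" "c = (x', y')"
    by (metis surj_pair)
  have "\<not> (x \<le> x' \<and> y \<le> y')" "\<not> (x' \<le> x \<and> y' \<le> y)"
    using linked_southeast[OF assms(1), of x y x' y'] linked_southeast[OF assms(1), of x' y' x y]
      linked_sym[of D c b] assms(2-) bc by auto
  then show ?thesis
    unfolding bc box_southwest_def by auto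
qed

text \<open>
  A step to an adjacent box changes one coordinate by one, so it cannot lead from strictly southwest
  of \<open>c\<close> to strictly northeast of \<open>c\<close>. Since each box of the component of \<open>b\<close>
  lies on one of these two sides, the whole component lies on the side of \<open>b\<close>.
\<close>

lemma box_southwest_linked:
  assumes D: "order_convex D" and c: "c \<in> D" and b: "b \<in> D" and bc: "\<not> linked D b c"
    and "linked D b b'"
  shows "(box_southwest b c \<longrightarrow> box_southwest b' c) \<and> (box_southwest c b \<longrightarrow> box_southwest c b')"
  using assms(5)
proof (induction rule: linked_induct)
  case (step p q)
  have "linked D b q"
    using step(1-4) by (rule linked_adjacent)
  then have "\<not> linked D q c"
    using bc linked_trans[of D b q c] by blast
  then have "box_southwest q c \<or> box_southwest c q"
    using unlinked_box_southwest[OF D _ c, of q] step(3) by simp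
  moreover have "box_southwest p c \<Longrightarrow> \<not> box_southwest c q" "box_southwest c p \<Longrightarrow> \<not> box_southwest q c"
    using step(4) by (auto simp: box_southwest_def adjacent_def)
  ultimately show ?case
    using step.IH by blast
qed simp

lemma southwest_of_component_iff:
  assumes D: "order_convex D" and b: "b \<in> D" and c: "c \<in> D" and bc: "\<not> linked D b c"
  shows "southwest_of (component D b) (component D c) \<longleftrightarrow> box_southwest b c"
proof -
  have "box_southwest b' c'" if sw: "box_southwest b c" and b': "linked D b b'" and c': "linked D c c'" for b' c'
  proof -
    have "box_southwest b' c"
      using box_southwest_linked[OF D c b bc b'] sw by blast
    moreover have "\<not> linked D c b'"
      using bc b' linked_sym linked_trans by blast
    ultimately show ?thesis
      using box_southwest_linked[OF D linked_mem[OF b' b] c _ c'] by blast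
  qed
  then have "box_southwest b c \<longleftrightarrow> (\<forall>b' c'. linked D b b' \<longrightarrow> linked D c c' \<longrightarrow> box_southwest b' c')"
    using linked_refl by blast
  then show ?thesis
    unfolding southwest_of_def linked_def box_southwest_def by blast
qed

text \<open>
  The comparison of components is replaced by a comparison of the two boxes themselves. In this form
  the reading order is seen to be a strict linear order on the shape.
\<close>

lemma read_before_iff:
  assumes "order_convex D" "b \<in> D" "c \<in> D"
  shows "read_before D b c \<longleftrightarrow>
    (if linked D b c then snd b < snd c \<or> (snd b = snd c \<and> fst b < fst c) else box_southwest b c)"
  using southwest_of_component_iff[OF assms] by (simp add: read_before_def component_eq_iff)

lemma read_before_irrefl: "\<not> read_before D b b"
  by (simp add: read_before_def)

lemma read_before_total:
  assumes "order_convex D" "b \<in> D" "c \<in> D" "b \<noteq> c"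
  shows "read_before D b c \<or> read_before D c b"
proof -
  have "linked D b c \<longleftrightarrow> linked D c b"
    using linked_sym by blast
  moreover have "fst b \<noteq> fst c \<or> snd b \<noteq> snd c"
    using assms(4) by (simp add: prod_eq_iff)
  ultimately show ?thesis
    using unlinked_box_southwest[OF assms(1-3)] assms(1-3)
    by (cases "linked D b c") (simp_all add: read_before_iff, linarith?)
qed

lemma read_before_trans:
  assumes D: "order_convex D" and mem: "b \<in> D" "c \<in> D" "d \<in> D"
    and bc: "read_before D b c" and cd: "read_before D c d"
  shows "read_before D b d"
proof (cases "linked D b c")
  case True
  show ?thesis
  proof (cases "linked D c d")
    case True
    then have "linked D b d"
      by (rule linked_trans[OF \<open>linked D b c\<close>])
    with True \<open>linked D b c\<close> show ?thesis
      using bc cd by (auto simp: read_before_iff[OF D] mem)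
  next
    case False
    then have "\<not> linked D b d"
      using True linked_sym linked_trans by blast
    moreover have "box_southwest b d"
      using box_southwest_linked[OF D mem(3,2) False linked_sym[OF True]] cd False
      by (simp add: read_before_iff[OF D] mem)
    ultimately show ?thesis
      by (simp add: read_before_iff[OF D] mem)
  qed
next
  case False
  then have sw: "box_southwest b c"
    using bc by (simp add: read_before_iff[OF D] mem)
  have cb: "\<not> linked D c b"
    using False linked_sym by blast
  show ?thesis
  proof (cases "linked D c d")
    case True
    then have "\<not> linked D b d"
      using False linked_sym linked_trans by blast
    then show ?thesis
      using box_southwest_linked[OF D mem(1,2) cb True] sw by (simp add: read_before_iff[OF D] mem)
  next
    case cd': False
    then have "box_southwest c d"
      using cd by (simp add: read_before_iff[OF D] mem)
    moreover from this have "\<not> linked D b d"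
      using box_southwest_linked[OF D mem(2,1) False, of d] sw by (auto simp: box_southwest_def)
    ultimately show ?thesis
      using sw by (auto simp: read_before_iff[OF D] mem box_southwest_def)
  qed
qed

text \<open>
  The entry of a box counts its predecessors in a linear order.
\<close>

lemma col_reading_strict:
  assumes D: "order_convex D" and fin: "finite D" and mem: "b \<in> D" "c \<in> D"
    and bc: "read_before D b c"
  shows "col_reading D b < col_reading D c"
proof -
  have "{d \<in> D. read_before D d b} \<subset> {d \<in> D. read_before D d c}"
  proof
    show "{d \<in> D. read_before D d b} \<subseteq> {d \<in> D. read_before D d c}"
      using read_before_trans[OF D _ mem _ bc] by blast
    show "{d \<in> D. read_before D d b} \<noteq> {d \<in> D. read_before D d c}"
      using bc mem read_before_irrefl by blast
  qed
  then show ?thesis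
    using mem fin by (simp add: col_reading_def psubset_card_mono)
qed

text \<open>
  Boxes in one row or one column of the shape lie in the same component, where the reading
  order runs through rows from left to right and through columns from top to bottom.
\<close>

lemma col_reading_SYT:
  assumes D: "order_convex D" and fin: "finite D"
  shows "col_reading D \<in> SYT D"
proof -
  have "inj_on (col_reading D) D"
    using col_reading_strict[OF D fin] read_before_total[OF D]
    by (metis inj_onI less_irrefl)
  moreover have "col_reading D ` D \<subseteq> {1..card D}"
  proof
    fix k assume "k \<in> col_reading D ` D"
    then obtain b where b: "b \<in> D" "k = card {c \<in> D. read_before D c b} + 1"
      by (auto simp: col_reading_def)
    have "{c \<in> D. read_before D c b} \<subset> D"
      using b read_before_irrefl by blast
    then show "k \<in> {1..card D}"
      using psubset_card_mono[OF fin] b by (simp add: Suc_le_eq)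
  qed
  ultimately have "bij_betw (col_reading D) D {1..card D}"
    by (simp add: bij_betw_def card_image card_subset_eq)
  moreover have "read_before D (x, y) (x, y')" if "(x, y) \<in> D" "(x, y') \<in> D" "y < y'" for x y y'
    using that linked_southeast[OF D that(1,2)] by (simp add: read_before_iff[OF D])
  moreover have "read_before D (x, y) (x', y)" if "(x, y) \<in> D" "(x', y) \<in> D" "x < x'" for x x' y
    using that linked_southeast[OF D that(1,2)] by (simp add: read_before_iff[OF D])
  moreover have "col_reading D b = 0" if "b \<notin> D" for b
    using that by (simp add: col_reading_def)
  ultimately show ?thesis
    unfolding SYT_def tableaux_def mem_Collect_eq using col_reading_strict[OF D fin] by blast
qed

section \<open>The permutation of a tableau\<close>

lemma SYT_tableaux: "T \<in> SYT D \<Longrightarrow> T \<in> tableaux D"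
  by (simp add: SYT_def)

lemma finite_tableaux:
  assumes "finite D"
  shows "finite (tableaux D)"
proof (rule finite_subset)
  show "tableaux D \<subseteq> {T. \<forall>b. (b \<in> D \<longrightarrow> T b \<in> {1..card D}) \<and> (b \<notin> D \<longrightarrow> T b = 0)}"
    by (auto simp: tableaux_def bij_betw_def)
  show "finite {T :: tableau. \<forall>b. (b \<in> D \<longrightarrow> T b \<in> {1..card D}) \<and> (b \<notin> D \<longrightarrow> T b = 0)}"
    using assms by (intro finite_set_of_finite_funs) auto
qed

lemma finite_SYT: "finite D \<Longrightarrow> finite (SYT D)"
  using finite_tableaux finite_subset[of "SYT D" "tableaux D"] SYT_tableaux by blast

lemma tableaux_eqI:
  assumes C: "C \<in> tableaux D" and w: "w permutes {1..card D}" and w': "w' permutes {1..card D}"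
    and eq: "w \<circ> C = w' \<circ> C"
  shows "w = w'"
proof
  fix k
  show "w k = w' k"
  proof (cases "k \<in> {1..card D}")
    case True
    then obtain b where "b \<in> D" "k = C b"
      using C unfolding tableaux_def bij_betw_def by blast
    then show ?thesis
      using eq by (metis comp_apply)
  next
    case False
    then show ?thesis
      using w w' by (simp add: permutes_def)
  qed
qed

lemma permutes_tableaux:
  assumes "T \<in> tableaux D" "w permutes {1..card D}"
  shows "w \<circ> T \<in> tableaux D"
proof -
  have "w 0 = 0"
    using assms(2) by (simp add: permutes_def)
  moreover have "bij_betw (w \<circ> T) D {1..card D}"
    using assms by (intro bij_betw_trans[of T D "{1..card D}"] permutes_imp_bij)
      (simp_all add: tableaux_def)
  ultimately show ?thesis
    using assms(1) by (simp add: tableaux_def)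
qed

lemma tableau_transition:
  assumes C: "C \<in> tableaux D" and T: "T \<in> tableaux D"
  shows "\<exists>w. w permutes {1..card D} \<and> w \<circ> C = T"
proof -
  have Cb: "bij_betw C D {1..card D}" and Tb: "bij_betw T D {1..card D}"
    using C T by (auto simp: tableaux_def)
  define w where "w k = (if k \<in> {1..card D} then T (inv_into D C k) else k)" for k
  have "bij_betw (T \<circ> inv_into D C) {1..card D} {1..card D}"
    using bij_betw_trans[OF bij_betw_inv_into[OF Cb] Tb] .
  moreover have "bij_betw (T \<circ> inv_into D C) {1..card D} {1..card D} \<longleftrightarrow>
      bij_betw w {1..card D} {1..card D}"
    by (rule bij_betw_cong) (simp add: w_def)
  ultimately have "bij_betw w {1..card D} {1..card D}"
    by blast
  then have "w permutes {1..card D}"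
    by (rule bij_imp_permutes) (simp only: w_def if_False)
  moreover have "w (C b) = T b" for b
  proof (cases "b \<in> D")
    case True
    then show ?thesis
      using bij_betw_inv_into_left[OF Cb True] bij_betwE[OF Cb] by (simp add: w_def)
  next
    case False
    then show ?thesis
      using C T by (auto simp: w_def tableaux_def simp del: split_paired_All)
  qed
  ultimately show ?thesis
    by (auto simp: fun_eq_iff)
qed

locale skew_shape =
  fixes D :: "box set"
  assumes finite_D: "finite D" and convex_D: "order_convex D"
begin

abbreviation "n \<equiv> card D"
abbreviation "C \<equiv> col_reading D"

lemma C_SYT: "C \<in> SYT D"
  using col_reading_SYT[OF convex_D finite_D] .

lemma tab_perm_unique:
  assumes "w permutes {1..n}" "w \<circ> C = T"
  shows "tab_perm D T = w"
  unfolding tab_perm_def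
proof (rule the_equality)
  show "w permutes {1..n} \<and> w \<circ> C = T"
    using assms by simp
  show "w' = w" if "w' permutes {1..n} \<and> w' \<circ> C = T" for w'
    using tableaux_eqI[OF SYT_tableaux[OF C_SYT], of w' w] that assms by simp
qed

lemma tab_perm:
  assumes "T \<in> tableaux D"
  shows "tab_perm D T permutes {1..n}" "tab_perm D T \<circ> C = T"
proof -
  obtain w where "w permutes {1..n}" "w \<circ> C = T"
    using tableau_transition[OF SYT_tableaux[OF C_SYT] assms] by blast
  moreover from this have "tab_perm D T = w"
    by (rule tab_perm_unique)
  ultimately show "tab_perm D T permutes {1..n}" "tab_perm D T \<circ> C = T"
    by simp_all
qed

lemma tab_perm_C: "tab_perm D C = id"
  by (rule tab_perm_unique) (simp_all only: permutes_id id_comp)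

lemma s_permutes: "1 \<le> i \<Longrightarrow> i < n \<Longrightarrow> s i permutes {1..n}"
  by (rule permutes_swap_id) auto

lemma tab_perm_s:
  assumes "T \<in> tableaux D" "1 \<le> i" "i < n"
  shows "tab_perm D (s i \<circ> T) = s i \<circ> tab_perm D T"
proof (rule tab_perm_unique)
  show "s i \<circ> tab_perm D T permutes {1..n}"
    using tab_perm(1)[OF assms(1)] s_permutes[OF assms(2,3)] by (rule permutes_compose)
  show "s i \<circ> tab_perm D T \<circ> C = s i \<circ> T"
    by (simp only: comp_assoc tab_perm(2)[OF assms(1)])
qed

end

section \<open>Inversions and the strong Bruhat order\<close>

definition inversions :: "nat \<Rightarrow> (nat \<Rightarrow> nat) \<Rightarrow> (nat \<times> nat) set" where
  "inversions n w = {(a, b). 1 \<le> a \<and> a < b \<and> b \<le> n \<and> w b < w a}"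

lemma perm_length_inversions: "perm_length n w = card (inversions n w)"
  by (simp add: perm_length_def inversions_def)

lemma finite_inversions: "finite (inversions n w)"
  by (rule finite_subset[of _ "{1..n} \<times> {1..n}"]) (auto simp: inversions_def)

text \<open>
  The map \<open>f\<close> in the proof sends an inversion of \<open>u\<close> to an inversion of the product: it
  moves both positions by the transposition if this keeps them in order, and leaves the pair alone
  otherwise. In the latter case one position is \<open>a\<close> or \<open>b\<close> and the other lies strictly
  between them, and \<open>u a < u b\<close> shows that the pair is still inverted. The map is injective and
  misses the new inversion \<open>(a, b)\<close>.
\<close>

lemma perm_length_transpose_less:
  assumes "1 \<le> a" "a < b" "b \<le> n" and u: "u a < u b"
  shows "perm_length n u < perm_length n (u \<circ> Transposition.transpose a b)"
proof -
  let ?t = "Transposition.transpose a b"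
  define f where "f = (\<lambda>(x, y). if ?t x < ?t y then (?t x, ?t y) else (x, y))"
  have image: "f (x, y) \<in> inversions n (u \<circ> ?t) - {(a, b)}" if "(x, y) \<in> inversions n u" for x y
  proof (cases "?t x < ?t y")
    case True
    moreover have "1 \<le> ?t x" "?t y \<le> n"
      using that assms by (auto simp: inversions_def Transposition.transpose_def)
    moreover have "(?t x, ?t y) \<noteq> (a, b)"
    proof
      assume "(?t x, ?t y) = (a, b)"
      then have "x = b" "y = a"
        by (metis Pair_inject transpose_apply_first transpose_apply_second transpose_involutory)+
      then show False
        using that assms(2) by (simp add: inversions_def)
    qed
    ultimately show ?thesis
      using that by (simp add: f_def inversions_def)
  next
    case False
    have "(u \<circ> ?t) y < (u \<circ> ?t) x \<and> (x, y) \<noteq> (a, b)"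
      using that assms False
      by (cases "x = a"; cases "x = b"; cases "y = a"; cases "y = b")
        (auto simp: inversions_def Transposition.transpose_def)
    then show ?thesis
      using that False by (simp add: f_def inversions_def)
  qed
  have "inj_on f (inversions n u)"
  proof (rule inj_onI)
    fix p q
    assume p: "p \<in> inversions n u" and q: "q \<in> inversions n u" and eq: "f p = f q"
    obtain x y x' y' where xy: "p = (x, y)" "q = (x', y')"
      by (metis surj_pair)
    have "x < y" "x' < y'"
      using p q by (auto simp: xy inversions_def)
    then show "p = q"
      using eq unfolding xy f_def prod.case
      by (cases "?t x < ?t y"; cases "?t x' < ?t y'") (auto simp: transpose_eq_iff)
  qed
  then have "card (inversions n u) = card (f ` inversions n u)"
    by (simp add: card_image)
  also have "\<dots> \<le> card (inversions n (u \<circ> ?t) - {(a, b)})"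
  proof (intro card_mono image_subsetI)
    show "f p \<in> inversions n (u \<circ> ?t) - {(a, b)}" if "p \<in> inversions n u" for p
      using image[of "fst p" "snd p"] that by (simp only: prod.collapse)
  qed (simp add: finite_inversions)
  also have "\<dots> < card (inversions n (u \<circ> ?t))"
    using assms finite_inversions by (intro card_Diff1_less) (simp_all add: inversions_def)
  finally show ?thesis
    by (simp add: perm_length_inversions)
qed

lemma bruhat_step_iff:
  assumes "bij u"
  shows "bruhat_step n u w \<longleftrightarrow> (\<exists>a b. 1 \<le> a \<and> a < b \<and> b \<le> n \<and>
    w = u \<circ> Transposition.transpose a b \<and> u a < u b)"
proof
  assume "bruhat_step n u w"
  then obtain a b where ab: "1 \<le> a" "a < b" "b \<le> n" and w: "w = u \<circ> Transposition.transpose a b"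
    and less: "perm_length n u < perm_length n w"
    unfolding bruhat_step_def by blast
  have "\<not> u b < u a"
    using perm_length_transpose_less[OF ab, of w] less by (auto simp: w comp_assoc)
  moreover have "u a \<noteq> u b"
    using ab(2) assms by (simp add: bij_def inj_eq)
  ultimately show "\<exists>a b. 1 \<le> a \<and> a < b \<and> b \<le> n \<and> w = u \<circ> Transposition.transpose a b \<and> u a < u b"
    using ab w by (metis linorder_neqE_nat)
next
  assume "\<exists>a b. 1 \<le> a \<and> a < b \<and> b \<le> n \<and> w = u \<circ> Transposition.transpose a b \<and> u a < u b"
  then show "bruhat_step n u w"
    unfolding bruhat_step_def using perm_length_transpose_less by blast
qed

lemma bij_bruhat_step: "bruhat_step n u w \<Longrightarrow> bij u \<Longrightarrow> bij w"
  unfolding bruhat_step_def by (auto intro: bij_comp)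

lemma transpose_conjugate:
  "bij u \<Longrightarrow> Transposition.transpose (u a) (u b) \<circ> u = u \<circ> Transposition.transpose a b"
  by (auto simp: fun_eq_iff Transposition.transpose_def bij_def inj_eq)

lemma s_strict_mono: "x < y \<Longrightarrow> \<not> (x = i \<and> y = i + 1) \<Longrightarrow> s i x < s i y"
  by (auto simp: Transposition.transpose_def)

text \<open>
  Composing with \<open>s i\<close> on the left reverses the order of two values only if they are \<open>i\<close> and
  \<open>i + 1\<close>. A step that exchanges precisely these two values is itself the composition with
  \<open>s i\<close>; any other step remains a step.
\<close>

lemma bruhat_step_s:
  assumes u: "bij u" and step: "bruhat_step n u w"
  shows "s i \<circ> u = w \<or> bruhat_step n (s i \<circ> u) (s i \<circ> w)"
proof -
  obtain a b where ab: "1 \<le> a" "a < b" "b \<le> n" and w: "w = u \<circ> Transposition.transpose a b"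
    and less: "u a < u b"
    using step bruhat_step_iff[OF u] by blast
  show ?thesis
  proof (cases "u a = i \<and> u b = i + 1")
    case True
    then have "s i \<circ> u = w"
      using transpose_conjugate[OF u, of a b] w by simp
    then show ?thesis ..
  next
    case False
    then have "(s i \<circ> u) a < (s i \<circ> u) b"
      using s_strict_mono[OF less] by simp
    moreover have "bij (s i \<circ> u)"
      using u by (simp add: bij_comp)
    moreover have "s i \<circ> w = s i \<circ> u \<circ> Transposition.transpose a b"
      by (simp add: w comp_assoc)
    ultimately show ?thesis
      using ab bruhat_step_iff by blast
  qed
qed

lemma bruhat_le_refl: "bruhat_le n u u"
  by (simp add: bruhat_le_def)

lemma bruhat_le_trans: "bruhat_le n u v \<Longrightarrow> bruhat_le n v w \<Longrightarrow> bruhat_le n u w"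
  unfolding bruhat_le_def by (rule rtranclp_trans)

lemma bruhat_step_le: "bruhat_step n u w \<Longrightarrow> bruhat_le n u w"
  unfolding bruhat_le_def by (rule r_into_rtranclp)

text \<open>
  The lifting property. Compose all members of a chain from \<open>u\<close> to \<open>w\<close> with \<open>s i\<close>.
  Either this is again a chain, ending in \<open>s i \<circ> w\<close>, or at the first step that
  is lost the composed chain meets the original one and can be continued along it up to \<open>w\<close>.
\<close>

lemma bruhat_le_s:
  assumes "bruhat_le n u w" "bij u"
  shows "bruhat_le n (s i \<circ> u) w \<or> bruhat_le n (s i \<circ> u) (s i \<circ> w)"
proof -
  have "(bruhat_step n)\<^sup>*\<^sup>* u w"
    using assms(1) by (simp add: bruhat_le_def)
  then show ?thesis
    using assms(2)
  proof (induction rule: converse_rtranclp_induct)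
    case base
    show ?case
      using bruhat_le_refl by blast
  next
    case (step u u')
    have u'w: "bruhat_le n u' w"
      using step.hyps(2) by (simp add: bruhat_le_def)
    have IH: "bruhat_le n (s i \<circ> u') w \<or> bruhat_le n (s i \<circ> u') (s i \<circ> w)"
      using step.IH bij_bruhat_step[OF step.hyps(1) step.prems] by blast
    show ?case
      using bruhat_step_s[OF step.prems step.hyps(1), of i] u'w IH
        bruhat_step_le bruhat_le_trans by blast
  qed
qed

section \<open>Paths and subpaths\<close>

lemma is_path_Nil: "is_path D T T' (Ts, []) \<longleftrightarrow> Ts = [T] \<and> T' = T \<and> T \<in> SYT D"
  by (cases Ts) (auto simp: is_path_def)

lemma is_path_snoc:
  "is_path D T T' (Ts, js @ [i]) \<longleftrightarrow>
    (\<exists>Us U. Ts = Us @ [T'] \<and> is_path D T U (Us, js) \<and> weak_edge D i U T')"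
proof (cases "\<exists>Us X. Ts = Us @ [X] \<and> length Us = length js + 1")
  case True
  then obtain Us X where Ts: "Ts = Us @ [X]" and len: "length Us = length js + 1"
    by blast
  have Us: "Us \<noteq> []"
    using len by auto
  have "(\<forall>j<length (js @ [i]). weak_edge D ((js @ [i]) ! j) (Ts ! j) (Ts ! (j + 1))) \<longleftrightarrow>
      (\<forall>j<length js. weak_edge D (js ! j) (Us ! j) (Us ! (j + 1))) \<and> weak_edge D i (last Us) X"
  proof -
    have "(js @ [i]) ! j = js ! j \<and> Ts ! j = Us ! j \<and> Ts ! (j + 1) = Us ! (j + 1)"
      if "j < length js" for j
      using that len by (simp add: Ts nth_append)
    moreover have "(js @ [i]) ! length js = i \<and> Ts ! length js = last Us \<and>
        Ts ! (length js + 1) = X"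
      using len Us by (simp add: Ts nth_append last_conv_nth)
    ultimately show ?thesis
      by (simp only: length_append_singleton All_less_Suc) metis
  qed
  then have "is_path D T T' (Ts, js @ [i]) \<longleftrightarrow>
      T' = X \<and> is_path D T (last Us) (Us, js) \<and> weak_edge D i (last Us) X"
    using len Us by (auto simp: is_path_def Ts weak_edge_def simp del: length_append_singleton)
  moreover have "U = last Us" if "is_path D T U (Us, js)" for U
    using that by (simp add: is_path_def)
  ultimately show ?thesis
    unfolding Ts by blast
next
  case False
  have "\<not> is_path D T T' (Ts, js @ [i])"
  proof
    assume "is_path D T T' (Ts, js @ [i])"
    then have "length Ts = Suc (length js + 1)"
      by (simp add: is_path_def)
    then show False
      using False by (metis length_Suc_conv_rev)
  qed
  moreover have "\<not> (Ts = Us @ [T'] \<and> is_path D T U (Us, js) \<and> weak_edge D i U T')" for Us U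
    using False unfolding is_path_def by auto
  ultimately show ?thesis
    by blast
qed

definition extend :: "(nat \<Rightarrow> nat) \<Rightarrow> subpath \<Rightarrow> subpath" where
  "extend z w = (fst w @ [z \<circ> terminus w], snd w @ [z])"

lemma terminus_extend [simp]: "terminus (extend z w) = z \<circ> terminus w"
  by (simp add: extend_def terminus_def)

lemma extend_eq_iff: "extend z w = extend z' w' \<longleftrightarrow> z = z' \<and> w = w'"
  by (cases w; cases w') (auto simp: extend_def)

lemma s_neq_id: "s i \<noteq> id"
  by (simp add: transpose_eq_id_iff)

lemma subpath_lengths:
  "is_subpath D w (Us, js) \<Longrightarrow> length (snd w) = length js \<and> length (fst w) = length js + 1"
  by (cases w) (simp add: is_subpath_def)

lemma subpath_terminus_SYT:
  assumes "is_subpath D w (Us, js)"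
  shows "terminus w \<in> SYT D"
proof -
  have "fst w \<noteq> []"
    using subpath_lengths[OF assms] by auto
  moreover have "set (fst w) \<subseteq> SYT D"
    using assms by (cases w) (simp add: is_subpath_def)
  ultimately show ?thesis
    unfolding terminus_def using last_in_set by blast
qed

lemma is_subpath_Nil: "T \<in> SYT D \<Longrightarrow> is_subpath D w ([T], []) \<longleftrightarrow> w = ([T], [])"
  by (cases w; cases "fst w") (auto simp: is_subpath_def)

lemma is_subpath_extend:
  assumes len: "length Us = length js + 1"
  shows "is_subpath D (extend z w) (Us @ [T], js @ [i]) \<longleftrightarrow>
    is_subpath D w (Us, js) \<and> z \<in> {s i, id} \<and> z \<circ> terminus w \<in> SYT D"
proof -
  obtain Ss zs where w: "w = (Ss, zs)"
    by (metis surj_pair)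
  show ?thesis
  proof (cases "length zs = length js \<and> length Ss = length js + 1")
    case True
    then have Ss: "Ss \<noteq> []" "Us \<noteq> []"
      using len by auto
    let ?S = "z \<circ> last Ss"
    have "(\<forall>j<length (zs @ [z]). (zs @ [z]) ! j \<in> {s ((js @ [i]) ! j), id} \<and>
          (Ss @ [?S]) ! (j + 1) = (zs @ [z]) ! j \<circ> (Ss @ [?S]) ! j) \<longleftrightarrow>
        (\<forall>j<length zs. zs ! j \<in> {s (js ! j), id} \<and> Ss ! (j + 1) = zs ! j \<circ> Ss ! j) \<and>
        z \<in> {s i, id}"
    proof -
      have "(zs @ [z]) ! j = zs ! j \<and> (js @ [i]) ! j = js ! j \<and> (Ss @ [?S]) ! j = Ss ! j \<and>
          (Ss @ [?S]) ! (j + 1) = Ss ! (j + 1)" if "j < length zs" for j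
        using that True by (simp add: nth_append)
      moreover have "(zs @ [z]) ! length zs = z \<and> (js @ [i]) ! length zs = i \<and>
          (Ss @ [?S]) ! length zs = last Ss \<and> (Ss @ [?S]) ! (length zs + 1) = ?S"
        using True Ss by (simp add: nth_append last_conv_nth)
      ultimately show ?thesis
        by (simp only: length_append_singleton All_less_Suc) metis
    qed
    then show ?thesis
      using True Ss unfolding w extend_def is_subpath_def terminus_def prod.case fst_conv snd_conv
      by auto
  next
    case False
    then show ?thesis
      by (auto simp: w extend_def is_subpath_def)
  qed
qed

lemma is_subpath_snocE:
  assumes len: "length Us = length js + 1"
    and sub: "is_subpath D w (Us @ [T], js @ [i])"
  obtains w' z where "w = extend z w'"
proof -
  obtain Ss zs where w: "w = (Ss, zs)"
    by (metis surj_pair)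
  have "length zs = Suc (length js)" "length Ss = Suc (length js + 1)"
    using subpath_lengths[OF sub] by (simp_all add: w)
  then obtain Ss' S zs' z where Ss: "Ss = Ss' @ [S]" "zs = zs' @ [z]"
    and l: "length Ss' = length js + 1" "length zs' = length js"
    by (metis length_Suc_conv_rev)
  have "\<forall>j<length zs. Ss ! (j + 1) = zs ! j \<circ> Ss ! j"
    using sub by (simp add: w is_subpath_def)
  then have "Ss ! (length js + 1) = zs ! length js \<circ> Ss ! length js"
    using l Ss by simp
  then have "S = z \<circ> last Ss'"
    using l Ss by (cases "Ss' = []") (auto simp: nth_append last_conv_nth)
  then have "w = extend z (Ss', zs')"
    by (simp add: w Ss extend_def terminus_def)
  then show thesis
    by (rule that)
qed

abbreviation subpaths :: "box set \<Rightarrow> path \<Rightarrow> subpath set" where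
  "subpaths D p \<equiv> {w. is_subpath D w p}"

text \<open>
  A subpath of a longer path stops or moves along the last edge; stopping is always possible,
  moving only if it leads to a standard tableau.
\<close>

lemma subpaths_snoc:
  assumes len: "length Us = length js + 1"
  shows "subpaths D (Us @ [T], js @ [i]) =
    extend id ` subpaths D (Us, js) \<union>
    extend (s i) ` {w \<in> subpaths D (Us, js). s i \<circ> terminus w \<in> SYT D}"
    (is "?L = ?R")
proof
  show "?L \<subseteq> ?R"
  proof
    fix w assume w: "w \<in> ?L"
    then obtain w' z where "w = extend z w'"
      using is_subpath_snocE[OF len] by blast
    then show "w \<in> ?R"
      using w is_subpath_extend[OF len, of D z w' T i] by auto
  qed
  show "?R \<subseteq> ?L"
    using is_subpath_extend[OF len] subpath_terminus_SYT by auto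
qed

lemma finite_subpaths:
  "is_path D T T' (Ts, js) \<Longrightarrow> finite (subpaths D (Ts, js))"
proof (induction js arbitrary: Ts T' rule: rev_induct)
  case Nil
  then show ?case
    by (simp add: is_path_Nil is_subpath_Nil)
next
  case (snoc i js)
  then obtain Us U where Us: "Ts = Us @ [T']" "is_path D T U (Us, js)"
    by (auto simp: is_path_snoc)
  then have "length Us = length js + 1"
    by (simp add: is_path_def)
  then show ?case
    using snoc.IH[OF Us(2)] by (simp add: Us(1) subpaths_snoc)
qed

lemma sum_subpaths_snoc:
  fixes f :: "subpath \<Rightarrow> 'a::comm_monoid_add"
  assumes len: "length Us = length js + 1" and fin: "finite (subpaths D (Us, js))"
  shows "sum f (subpaths D (Us @ [T], js @ [i])) =
    (\<Sum>w\<in>subpaths D (Us, js). f (extend id w) +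
      (if s i \<circ> terminus w \<in> SYT D then f (extend (s i) w) else 0))"
proof -
  let ?P = "subpaths D (Us, js)"
  let ?Q = "{w \<in> ?P. s i \<circ> terminus w \<in> SYT D}"
  have inj: "inj_on (extend z) A" for z A
    by (simp add: inj_on_def extend_eq_iff)
  have "extend id ` ?P \<inter> extend (s i) ` ?Q = {}"
    using s_neq_id[of i] by (auto simp: extend_eq_iff)
  then have "sum f (subpaths D (Us @ [T], js @ [i])) =
      sum f (extend id ` ?P) + sum f (extend (s i) ` ?Q)"
    using fin by (simp add: subpaths_snoc[OF len] sum.union_disjoint)
  also have "\<dots> = (\<Sum>w\<in>?P. f (extend id w)) + (\<Sum>w\<in>?Q. f (extend (s i) w))"
    by (simp add: sum.reindex[OF inj])
  also have "(\<Sum>w\<in>?Q. f (extend (s i) w)) =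
      (\<Sum>w\<in>?P. if s i \<circ> terminus w \<in> SYT D then f (extend (s i) w) else 0)"
    using fin by (rule sum.inter_filter)
  finally show ?thesis
    by (simp only: sum.distrib)
qed

lemma wt_extend:
  assumes "is_subpath D w (Us, js)"
  shows "wt D (Us @ [T], js @ [i]) (extend z w) = wt D (Us, js) w *
    (if z = id then seminormal_coeff D i (terminus w) else 1 + seminormal_coeff D i (terminus w))"
proof -
  obtain Ss zs where w: "w = (Ss, zs)"
    by (metis surj_pair)
  have len: "length zs = length js" "length Ss = length js + 1"
    using subpath_lengths[OF assms] by (simp_all add: w)
  then have "Ss \<noteq> []"
    by auto
  then have "last Ss = Ss ! length js"
    using len by (simp add: last_conv_nth)
  moreover have "(\<Prod>j<length js. if (zs @ [z]) ! j = id
        then seminormal_coeff D ((js @ [i]) ! j) ((Ss @ [S]) ! j)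
        else 1 + seminormal_coeff D ((js @ [i]) ! j) ((Ss @ [S]) ! j)) =
      (\<Prod>j<length js. if zs ! j = id then seminormal_coeff D (js ! j) (Ss ! j)
        else 1 + seminormal_coeff D (js ! j) (Ss ! j))" for S
    by (rule prod.cong) (auto simp: nth_append len)
  ultimately show ?thesis
    by (simp add: w wt_def extend_def terminus_def lessThan_Suc nth_append len mult.commute)
qed

section \<open>Reduced paths from the column reading tableau\<close>

context skew_shape
begin

lemma bij_tab_perm: "T \<in> SYT D \<Longrightarrow> bij (tab_perm D T)"
  using tab_perm(1)[OF SYT_tableaux] by (rule permutes_bij)

text \<open>
  If the inverse permutation had no descent, it would increase along \<open>1, \<dots>, n\<close> and so never lie
  below the identity, which forces it to be the identity.
\<close>

lemma ex_descent:
  assumes w: "w permutes {1..n}" and "w \<noteq> id"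
  shows "\<exists>i. 1 \<le> i \<and> i < n \<and> inv_into UNIV w (i + 1) < inv_into UNIV w i"
proof (rule ccontr)
  assume no: "\<not> ?thesis"
  have q: "inv_into UNIV w permutes {1..n}"
    using w by (rule permutes_inv)
  have less: "inv_into UNIV w i < inv_into UNIV w (i + 1)" if "1 \<le> i" "i < n" for i
  proof -
    have "inv_into UNIV w i \<noteq> inv_into UNIV w (i + 1)"
      using permutes_inj[OF q] by (simp add: inj_eq)
    then show ?thesis
      using no that by (meson linorder_neqE_nat)
  qed
  have ge: "k \<le> inv_into UNIV w k" if "1 \<le> k" "k \<le> n" for k
    using that
  proof (induction k rule: nat_induct_at_least)
    case base
    then have "inv_into UNIV w 1 \<in> {1..n}"
      using permutes_in_image[OF q, of 1] by simp
    then show ?case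
      by simp
  next
    case (Suc k)
    then show ?case
      using less[of k] by simp
  qed
  have "inv_into UNIV w = id"
    using q by (rule permutes_natset_ge) (simp add: ge)
  then have "w = id"
    using permutes_inv_inv[OF w] by (metis inv_id)
  then show False
    using \<open>w \<noteq> id\<close> by simp
qed

text \<open>
  With \<open>w\<close> the permutation of \<open>T\<close>, the value of \<open>C\<close> at the box of \<open>k\<close> in
  \<open>T\<close> is the preimage of \<open>k\<close> under \<open>w\<close>. A descent of the inverse at \<open>i\<close> thus
  says that \<open>C\<close> has the boxes of \<open>i\<close> and \<open>i + 1\<close> in the opposite order. The
  exchange of these two entries respects every inequality on which \<open>T\<close> and
  \<open>C\<close> agree, in particular those required of a standard tableau.
\<close>

lemma ex_weak_edge_below:
  assumes T: "T \<in> SYT D" and "T \<noteq> C"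
  shows "\<exists>i S. weak_edge D i S T \<and> bruhat_step n (tab_perm D S) (tab_perm D T)"
proof -
  let ?w = "tab_perm D T"
  have w: "?w permutes {1..n}" "?w \<circ> C = T"
    using tab_perm[OF SYT_tableaux[OF T]] by simp_all
  have "?w \<noteq> id"
    using w(2) \<open>T \<noteq> C\<close> by (metis id_comp)
  then obtain i where i: "1 \<le> i" "i < n" and desc: "inv_into UNIV ?w (i + 1) < inv_into UNIV ?w i"
    using ex_descent[OF w(1)] by blast
  let ?S = "s i \<circ> T"
  have C_box: "C b = inv_into UNIV ?w (T b)" for b
    using w permutes_inverses(2)[OF w(1)] by (metis comp_apply)
  have keep: "?S b < ?S c" if "T b < T c" "C b < C c" for b c
  proof -
    have "\<not> (T b = i \<and> T c = i + 1)"
      using that(2) desc C_box[of b] C_box[of c] by auto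
    from s_strict_mono[OF that(1) this] show ?thesis
      by (simp only: comp_apply)
  qed
  have "?S \<in> SYT D"
    using permutes_tableaux[OF SYT_tableaux[OF T] s_permutes[OF i]] keep T C_SYT
    unfolding SYT_def mem_Collect_eq by blast
  then have edge: "weak_edge D i ?S T"
    using T i by (simp add: weak_edge_def comp_assoc[symmetric])
  let ?a = "inv_into UNIV ?w (i + 1)" and ?b = "inv_into UNIV ?w i"
  have w': "tab_perm D ?S = s i \<circ> ?w"
    using tab_perm_s[OF SYT_tableaux[OF T] i] .
  have wab: "?w ?a = i + 1" "?w ?b = i"
    using permutes_inverses(1)[OF w(1)] by simp_all
  have "bij ?w"
    using T by (rule bij_tab_perm)
  then have "?w \<circ> Transposition.transpose ?a ?b = s i \<circ> ?w"
    using transpose_conjugate[of ?w ?a ?b] wab by (simp add: transpose_commute)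
  then have "?w = s i \<circ> ?w \<circ> Transposition.transpose ?a ?b"
    by (metis comp_assoc comp_id transpose_comp_involutory)
  moreover have "?a \<in> {1..n}" "?b \<in> {1..n}"
    using permutes_in_image[OF permutes_inv[OF w(1)]] i by auto
  moreover have "(s i \<circ> ?w) ?a < (s i \<circ> ?w) ?b"
    using wab by simp
  moreover have "bij (s i \<circ> ?w)"
    using \<open>bij ?w\<close> by (simp add: bij_comp)
  ultimately have "bruhat_step n (s i \<circ> ?w) ?w"
    using desc bruhat_step_iff[of "s i \<circ> ?w" n ?w] by (metis atLeastAtMost_iff)
  then show ?thesis
    using edge w' by metis
qed

text \<open>
  The inductive step of the subword property. For a subpath that stays at the last edge it is
  transitivity; for one that moves along that edge it is the lifting property, whose two cases both end
  below \<open>T\<close> because the edge leads upwards.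
\<close>

lemma tab_le_s:
  assumes S: "S \<in> SYT D" and le: "tab_le D S T'" and edge: "weak_edge D i T' T"
    and step: "bruhat_step n (tab_perm D T') (tab_perm D T)" and "z \<in> {s i, id}"
  shows "tab_le D (z \<circ> S) T"
proof -
  have i: "1 \<le> i" "i < n" and T': "T' \<in> SYT D" and T: "T = s i \<circ> T'"
    using edge by (simp_all add: weak_edge_def)
  have sT: "s i \<circ> tab_perm D T' = tab_perm D T"
    using tab_perm_s[OF SYT_tableaux[OF T'] i] T by simp
  have le': "bruhat_le n (tab_perm D S) (tab_perm D T')"
    using le by (simp add: tab_le_def)
  have up: "bruhat_le n (tab_perm D T') (tab_perm D T)"
    using step by (rule bruhat_step_le)
  show ?thesis
  proof (cases "z = id")
    case True
    then show ?thesis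
      using bruhat_le_trans[OF le' up] by (simp add: tab_le_def)
  next
    case False
    then have "z = s i"
      using assms(5) by simp
    moreover have "bruhat_le n (s i \<circ> tab_perm D S) (tab_perm D T)"
      using bruhat_le_s[OF le' bij_tab_perm[OF S], of i] bruhat_le_trans[OF _ up] sT by metis
    ultimately show ?thesis
      using tab_perm_s[OF SYT_tableaux[OF S] i] by (simp add: tab_le_def)
  qed
qed

text \<open>
  The path is reduced because every edge raises the length. What is recorded is the consequence
  of this for its subpaths, which arbitrary paths do not share.
\<close>

lemma ex_reduced_path:
  assumes "T \<in> SYT D"
  shows "\<exists>p. is_path D C T p \<and> (\<forall>w. is_subpath D w p \<longrightarrow> tab_le D (terminus w) T)"
  using assms
proof (induction "perm_length n (tab_perm D T)" arbitrary: T rule: less_induct)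
  case less
  show ?case
  proof (cases "T = C")
    case True
    then have "is_path D C T ([C], [])"
      using C_SYT by (simp add: is_path_Nil)
    moreover have "tab_le D (terminus w) T" if "is_subpath D w ([C], [])" for w
      using that True C_SYT by (simp add: is_subpath_Nil terminus_def tab_le_def bruhat_le_refl)
    ultimately show ?thesis
      by blast
  next
    case False
    obtain i S where edge: "weak_edge D i S T"
      and step: "bruhat_step n (tab_perm D S) (tab_perm D T)"
      using ex_weak_edge_below[OF less.prems False] by blast
    have "perm_length n (tab_perm D S) < perm_length n (tab_perm D T)"
      using step by (simp add: bruhat_step_def)
    moreover have "S \<in> SYT D"
      using edge by (simp add: weak_edge_def)
    ultimately obtain Us js where p: "is_path D C S (Us, js)"
      and sub: "\<forall>w. is_subpath D w (Us, js) \<longrightarrow> tab_le D (terminus w) S"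
      using less.hyps[of S] by auto
    have len: "length Us = length js + 1"
      using p by (simp add: is_path_def)
    have "tab_le D (terminus w) T" if w: "is_subpath D w (Us @ [T], js @ [i])" for w
    proof -
      obtain w' z where ext: "w = extend z w'"
        using is_subpath_snocE[OF len w] by blast
      then have w': "is_subpath D w' (Us, js)" and z: "z \<in> {s i, id}"
        using w is_subpath_extend[OF len] by blast+
      have "tab_le D (z \<circ> terminus w') T"
        using sub w' by (intro tab_le_s[OF subpath_terminus_SYT[OF w'] _ edge step z]) blast
      then show ?thesis
        by (simp add: ext)
    qed
    moreover have "is_path D C T (Us @ [T], js @ [i])"
      using p edge is_path_snoc by blast
    ultimately show ?thesis
      by blast
  qed
qed

end

section \<open>Expansion of the natural basis along a path\<close>

locale seminormal_shape =
  skew_shape D + seminormal_module scale D act v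
  for D :: "box set"
    and scale :: "complex \<Rightarrow> 'v::ab_group_add \<Rightarrow> 'v"
    and act :: "(nat \<Rightarrow> nat) \<Rightarrow> 'v \<Rightarrow> 'v"
    and v :: "tableau \<Rightarrow> 'v"
begin

lemma act_comp:
  assumes "p permutes {1..n}" "q permutes {1..n}"
  shows "act (p \<circ> q) x = act p (act q x)"
proof -
  interpret A: group_action "sym_group n" UNIV act
    by (rule action)
  show ?thesis
    using A.composition_rule[of x p q] assms by (simp add: sym_group_def)
qed

lemma act_id: "act id x = x"
proof -
  interpret A: group_action "sym_group n" UNIV act
    by (rule action)
  have "act id = (\<lambda>x \<in> UNIV. x)"
    using A.id_eq_one by (simp add: sym_group_def)
  then show ?thesis
    by simp
qed

text \<open>
  By induction on the path: the last label acts on each term of the expansion by the seminormal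
  formula, whose two summands are the weights of the two ways to extend the corresponding subpath.
  If moving would leave the standard tableaux, the second summand is 0 and there is only one
  extension.
\<close>

lemma act_tab_perm_path:
  "is_path D C T (Ts, js) \<Longrightarrow>
    act (tab_perm D T) (v C) = (\<Sum>w\<in>subpaths D (Ts, js). scale (wt D (Ts, js) w) (v (terminus w)))"
proof (induction js arbitrary: Ts T rule: rev_induct)
  case Nil
  then have "Ts = [C]" "T = C"
    by (simp_all add: is_path_Nil)
  moreover have "act (tab_perm D C) (v C) = v C"
    by (simp only: tab_perm_C act_id)
  ultimately show ?case
    by (simp add: is_subpath_Nil C_SYT wt_def terminus_def)
next
  case (snoc i js)
  then obtain Us U where Ts: "Ts = Us @ [T]" and p: "is_path D C U (Us, js)"
    and edge: "weak_edge D i U T"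
    by (auto simp: is_path_snoc)
  have i: "1 \<le> i" "i < n" and U: "U \<in> SYT D" and T: "T = s i \<circ> U"
    using edge by (simp_all add: weak_edge_def)
  have len: "length Us = length js + 1"
    using p by (simp add: is_path_def)
  interpret L: Vector_Spaces.linear scale scale "act (s i)"
    using linear_act[OF s_permutes[OF i]] .
  let ?P = "subpaths D (Us, js)" and ?wt = "wt D (Us, js)"
  let ?a = "\<lambda>w. seminormal_coeff D i (terminus w)"
  have summand: "scale (?wt w) (act (s i) (v (terminus w))) =
      scale (wt D (Us @ [T], js @ [i]) (extend id w)) (v (terminus (extend id w))) +
      (if s i \<circ> terminus w \<in> SYT D
       then scale (wt D (Us @ [T], js @ [i]) (extend (s i) w)) (v (terminus (extend (s i) w)))
       else 0)" if "w \<in> ?P" for w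
  proof -
    have w: "is_subpath D w (Us, js)"
      using that by simp
    have "scale (?wt w) (act (s i) (v (terminus w))) =
        scale (?wt w * ?a w) (v (terminus w)) +
        scale (?wt w * (1 + ?a w)) (if s i \<circ> terminus w \<in> SYT D then v (s i \<circ> terminus w) else 0)"
      using act_s[OF subpath_terminus_SYT[OF w] i] by (simp add: scale_right_distrib)
    then show ?thesis
      using s_neq_id[of i] by (simp add: wt_extend[OF w])
  qed
  have "act (tab_perm D T) (v C) = act (s i) (act (tab_perm D U) (v C))"
    using tab_perm_s[OF SYT_tableaux[OF U] i] act_comp[OF s_permutes[OF i]]
      tab_perm(1)[OF SYT_tableaux[OF U]] by (simp add: T)
  also have "\<dots> = (\<Sum>w\<in>?P. scale (?wt w) (act (s i) (v (terminus w))))"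
    by (simp only: snoc.IH[OF p] L.sum L.scale)
  also have "\<dots> = (\<Sum>w\<in>subpaths D (Us @ [T], js @ [i]).
      scale (wt D (Us @ [T], js @ [i]) w) (v (terminus w)))"
    unfolding sum_subpaths_snoc[OF len finite_subpaths[OF p]]
    by (rule sum.cong[OF refl]) (rule summand)
  finally show ?case
    by (simp add: Ts)
qed

lemma natural_vector_path:
  assumes "is_path D C T p"
  shows "natural_vector D act v T = (\<Sum>S\<in>SYT D. scale (path_coeff D p S) (v S))"
proof -
  obtain Ts js where p: "p = (Ts, js)"
    by (metis surj_pair)
  let ?P = "subpaths D p"
  have path: "is_path D C T (Ts, js)"
    using assms p by simp
  have "natural_vector D act v T = (\<Sum>w\<in>?P. scale (wt D p w) (v (terminus w)))"
    using act_tab_perm_path[OF path] by (simp add: natural_vector_def p)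
  also have "\<dots> = (\<Sum>S\<in>SYT D. \<Sum>w | w \<in> ?P \<and> terminus w = S. scale (wt D p w) (v (terminus w)))"
    using finite_subpaths[OF path] finite_SYT[OF finite_D] subpath_terminus_SYT[of D _ Ts js]
    by (intro sum.group[symmetric]) (auto simp: p)
  also have "\<dots> = (\<Sum>S\<in>SYT D. scale (path_coeff D p S) (v S))"
    unfolding path_coeff_def scale_sum_left by (intro sum.cong) auto
  finally show ?thesis .
qed

lemma coefficients_unique:
  assumes eq: "(\<Sum>S\<in>SYT D. scale (f S) (v S)) = (\<Sum>S\<in>SYT D. scale (g S) (v S))"
    and S: "S \<in> SYT D"
  shows "f S = g S"
proof -
  \<comment> \<open>Independence speaks of coefficients indexed by vectors, so the tableau is recovered from its
    vector.\<close>
  let ?u = "\<lambda>x. f (inv_into (SYT D) v x) - g (inv_into (SYT D) v x)"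
  have "(\<Sum>x\<in>v ` SYT D. scale (?u x) x) = (\<Sum>S\<in>SYT D. scale (f S - g S) (v S))"
    using inj_v by (simp add: sum.reindex)
  also have "\<dots> = 0"
    using eq by (simp add: scale_left_diff_distrib sum_subtractf)
  finally have "?u (v S) = 0"
    using independentD[OF independent_v _ subset_refl, of ?u "v S"] finite_SYT[OF finite_D] S by simp
  then show ?thesis
    using inj_v S by simp
qed

text \<open>
  The expansion along any path has the same coefficients as the expansion along a reduced path, where
  a coefficient outside the Bruhat interval is an empty sum.
\<close>

lemma path_coeff_support:
  assumes T: "T \<in> SYT D" and p: "is_path D C T p" and S: "S \<in> SYT D" "path_coeff D p S \<noteq> 0"
  shows "tab_le D S T"
proof -
  obtain r where r: "is_path D C T r" and le: "\<forall>w. is_subpath D w r \<longrightarrow> tab_le D (terminus w) T"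
    using ex_reduced_path[OF T] by blast
  have "path_coeff D p S = path_coeff D r S"
    using natural_vector_path[OF p] natural_vector_path[OF r] S(1)
    by (intro coefficients_unique) simp_all
  then have "{w. is_subpath D w r \<and> terminus w = S} \<noteq> {}"
    using S(2) unfolding path_coeff_def by (metis sum.empty)
  then show ?thesis
    using le by blast
qed

end

theorem theorem4p7:
  fixes lam mu :: "nat list"
    and D :: "box set"
    and scale :: "complex \<Rightarrow> 'v::ab_group_add \<Rightarrow> 'v"
    and act :: "(nat \<Rightarrow> nat) \<Rightarrow> 'v \<Rightarrow> 'v"
    and v :: "tableau \<Rightarrow> 'v"
    and T :: tableau
  assumes "is_partition lam" and "is_partition mu" and "diagram mu \<subseteq> diagram lam"
    and "D = skew lam mu"
    and "seminormal_module scale D act v"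
    and "T \<in> SYT D"
  shows "(\<exists>p. is_path D (col_reading D) T p) \<and>
    (\<forall>p. is_path D (col_reading D) T p \<longrightarrow>
      natural_vector D act v T =
        (\<Sum>S \<in> {S \<in> SYT D. tab_le D S T}. scale (path_coeff D p S) (v S)))"
proof -
  interpret M: seminormal_module scale D act v
    by (rule assms(5))
  interpret seminormal_shape D scale act v
    by unfold_locales (simp_all add: assms(4) finite_skew skew_order_convex assms(1,2))
  have "natural_vector D act v T =
      (\<Sum>S \<in> {S \<in> SYT D. tab_le D S T}. scale (path_coeff D p S) (v S))"
    if p: "is_path D (col_reading D) T p" for p
    unfolding natural_vector_path[OF p]
  proof (rule sum.mono_neutral_right)
    show "finite (SYT D)"
      using finite_SYT[OF finite_D] .
    show "\<forall>S\<in>SYT D - {S \<in> SYT D. tab_le D S T}. scale (path_coeff D p S) (v S) = 0"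
    proof
      fix S assume "S \<in> SYT D - {S \<in> SYT D. tab_le D S T}"
      then have "path_coeff D p S = 0"
        using path_coeff_support[OF assms(6) p] by blast
      then show "scale (path_coeff D p S) (v S) = 0"
        by simp
    qed
  qed blast
  then show ?thesis
    using ex_reduced_path[OF assms(6)] by blast
qed

end
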